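(* Let $A$ be a finite-dimensional affine space over a field, let $V$ be a finite nonempty set of dimension vectors, each with at most $t$ coordinates, and let $k=\max_{\vec v\in V}\max_i v_i$. Then $$C_A(V)\le\binom{t+k+1}{k+1}.$$
   Context: A dimension vector is a vector $\vec v=(v_1,\dots,v_m)$ (of some length $m\ge1$) of non-negative integers with $v_1\ge\dots\ge v_m$; different vectors in $V$ may have different lengths. A set $S\subset A$ is covered by $\vec v=(v_1,\dots,v_m)$ if there are affine subspaces $L_1,\dots,L_m$ of $A$ with $\dim L_i=v_i$ for each $i$ and $S\subseteq L_1\cup\dots\cup L_m$. $S$ is covered by $V$ if it is covered by some $\vec v\in V$. $C_A(V)$ denotes the least $N$ such that, for every finite $S\subset A$, if every subset of $S$ of size at most $N$ is covered by $V$, then $S$ is covered by $V$. Equivalently, $C_A(V)$ is the largest size of a finite set $S\subset A$ that is nearly covered by $V$, i.e. $S$ is not covered by $V$ but every proper subset of $S$ is covered by $V$. *)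

theory Defs
  imports Complex_Main "HOL-Library.Extended_Nat"
begin

text \<open>
  A finite-dimensional affine space over a field: the point type \<open>'p\<close> is a torsor
  (a simply transitive action) under the additive group of a finite-dimensional vector space.
\<close>

locale fin_dim_affine_space = vector_space scale
  for scale :: "'k::field \<Rightarrow> 'v::ab_group_add \<Rightarrow> 'v" (infixr \<open>*s\<close> 75) +
  fixes translate :: "'p \<Rightarrow> 'v \<Rightarrow> 'p" (infixl \<open>\<oplus>\<close> 65)
  assumes translate_zero: "p \<oplus> 0 = p"
    and translate_add: "p \<oplus> u \<oplus> w = p \<oplus> (u + w)"
    and translate_unique: "\<exists>!w. p \<oplus> w = q"
    and finite_dimensional: "\<exists>B. finite B \<and> span B = UNIV"
begin

text \<open>
  The direction \<open>W\<close> is determined by \<open>L\<close>, so \<open>n\<close> is too. An affine subspace is never empty.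
\<close>

definition affine_subspace_of_dim :: "'p set \<Rightarrow> nat \<Rightarrow> bool" where
  "affine_subspace_of_dim L n \<longleftrightarrow>
     (\<exists>p W. subspace W \<and> dim W = n \<and> L = (\<lambda>w. p \<oplus> w) ` W)"

definition covered_by_vector :: "'p set \<Rightarrow> nat list \<Rightarrow> bool" where
  "covered_by_vector S v \<longleftrightarrow>
     (\<exists>L. (\<forall>i < length v. affine_subspace_of_dim (L i) (v ! i)) \<and> S \<subseteq> (\<Union>i < length v. L i))"

definition covered_by :: "'p set \<Rightarrow> nat list set \<Rightarrow> bool" where
  "covered_by S V \<longleftrightarrow> (\<exists>v\<in>V. covered_by_vector S v)"

text \<open>
  The infimum in \<^typ>\<open>enat\<close> is the least such \<open>N\<close>, and \<open>\<infinity>\<close> if there is none.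
  Thus a finite upper bound includes the claim that such an \<open>N\<close> exists.
\<close>

definition covering_number :: "nat list set \<Rightarrow> enat" where
  "covering_number V =
     Inf {enat N | N. \<forall>S. finite S \<longrightarrow>
                        (\<forall>T. T \<subseteq> S \<and> card T \<le> N \<longrightarrow> covered_by T V) \<longrightarrow> covered_by S V}"

end

definition dimension_vector :: "nat list \<Rightarrow> bool" where
  "dimension_vector v \<longleftrightarrow> v \<noteq> [] \<and> sorted_wrt (\<ge>) v"

end

theory Submission
  imports Defs "HOL-Library.Function_Algebras" "HOL-Computational_Algebra.Fraction_Field"
    "HOL-Computational_Algebra.Polynomial"
begin

text \<open>
  A minimal uncovered set \<open>S\<close> assigns to each \<open>x \<in> S\<close> at most \<open>t\<close> affine subspaces of dimension
  at most \<open>k\<close> that miss \<open>x\<close> and together contain \<open>S - {x}\<close>. If there are \<open>k + 2\<close> affine functions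
  (homogeneous coordinates of a projection to a space of dimension \<open>k + 1\<close>) such that each of these
  subspaces is separated from its \<open>x\<close> by a linear combination of them, the product of the separating
  functions for \<open>x\<close> vanishes on \<open>S - {x}\<close> but not at \<open>x\<close>. So these products are linearly independent
  forms of degree \<open>t\<close> in \<open>k + 2\<close> variables, and there are at most \<open>(t + k + 1) choose (k + 1)\<close> of
  them. Generic affine functions have this property; to have enough of them over a finite field,
  they take values in an infinite extension field.
\<close>

section \<open>Generic complements\<close>

context vector_space
begin

text \<open>Induction on the family. Let \<open>u\<close> avoid the earlier subspaces and lie in the
  new one \<open>M\<close>, and let \<open>v\<close> in \<open>G\<close> avoid \<open>M\<close>.
  Every point of the line \<open>v + c *s u\<close> avoids \<open>M\<close>, and each earlier
  \<open>N\<close>, not containing \<open>u\<close>, meets the line for at most one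
  \<open>c\<close>. An infinite field leaves a value of \<open>c\<close> that is good for all of
  them.\<close>

lemma subspace_avoids_finite_union:
  assumes "infinite (UNIV :: 'a set)" and "subspace G"
    and "finite \<N>" and "\<And>N. N \<in> \<N> \<Longrightarrow> subspace N \<and> \<not> G \<subseteq> N"
  shows "\<exists>g\<in>G. \<forall>N\<in>\<N>. g \<notin> N"
  using assms(3,4)
proof (induction \<N> rule: finite_induct)
  case empty
  show ?case using subspace_0[OF \<open>subspace G\<close>] by blast
next
  case (insert M \<N>)
  then obtain u where u: "u \<in> G" "\<forall>N\<in>\<N>. u \<notin> N" by auto
  show ?case
  proof (cases "u \<in> M")
    case False
    with u show ?thesis by blast
  next
    case True
    have M: "subspace M" using insert.prems by blast
    obtain v where v: "v \<in> G" "v \<notin> M" using insert.prems by blast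
    have "finite {c. v + c *s u \<in> N}" if N: "N \<in> \<N>" for N
    proof -
      have "subspace N" using insert.prems N by blast
      have "c = d" if "v + c *s u \<in> N" "v + d *s u \<in> N" for c d
      proof (rule ccontr)
        assume "c \<noteq> d"
        have "(c - d) *s u \<in> N"
          using subspace_diff[OF \<open>subspace N\<close> that] by (simp add: scale_left_diff_distrib)
        then have "inverse (c - d) *s (c - d) *s u \<in> N"
          using subspace_scale[OF \<open>subspace N\<close>] by blast
        with \<open>c \<noteq> d\<close> u N show False by simp
      qed
      then have "\<exists>c. {c. v + c *s u \<in> N} \<subseteq> {c}" by blast
      then show ?thesis using finite_subset by blast
    qed
    then have "finite (\<Union>N\<in>\<N>. {c. v + c *s u \<in> N})" using insert.hyps by blast
    then obtain c where c: "c \<notin> (\<Union>N\<in>\<N>. {c. v + c *s u \<in> N})"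
      using assms(1) ex_new_if_finite by blast
    have "v + c *s u \<in> G"
      using u v \<open>subspace G\<close> by (simp add: subspace_add subspace_scale)
    moreover have "v + c *s u \<notin> M"
      using v subspace_diff[OF M _ subspace_scale[OF M True, of c], of "v + c *s u"] by auto
    ultimately show ?thesis using c by blast
  qed
qed

text \<open>Steinitz exchange modulo \<open>span N\<close>: discard elements of \<open>B\<close> one
  by one. The element whose removal first expels \<open>g\<close> from the span is expressible
  through \<open>g\<close> and the remaining ones.\<close>

lemma span_exchange_modulo:
  assumes "finite B" and "g \<in> span (B \<union> N)" and "g \<notin> span N"
  shows "\<exists>b\<in>B. b \<in> span (insert g (B - {b} \<union> N))"
  using assms(1,2)
proof (induction B rule: finite_induct)
  case empty
  with assms(3) show ?case by simp
next
  case (insert b B)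
  show ?case
  proof (cases "g \<in> span (B \<union> N)")
    case True
    then obtain c where "c \<in> B" "c \<in> span (insert g (B - {c} \<union> N))"
      using insert.IH by blast
    moreover have "insert g (B - {c} \<union> N) \<subseteq> insert g (insert b B - {c} \<union> N)" by blast
    ultimately show ?thesis using span_mono by blast
  next
    case False
    then have "b \<in> span (insert g (B \<union> N))" using insert.prems in_span_insert by auto
    then show ?thesis using insert.hyps by auto
  qed
qed

text \<open>Greedy choice: pick \<open>g\<close> in \<open>G\<close> outside every
  \<open>span N\<close> that does not yet contain \<open>G\<close>. By exchange, passing from
  \<open>N\<close> to \<open>insert g N\<close> saves one of the vectors of \<open>B\<close>, for
  all \<open>N\<close> at the same time. So one list of \<open>n\<close> vectors completes every
  \<open>N\<close>.\<close>

lemma common_complement_of_subspaces: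
  assumes "infinite (UNIV :: 'a set)" and "subspace G"
    and "finite \<N>" and "\<And>N. N \<in> \<N> \<Longrightarrow> \<exists>B. finite B \<and> card B \<le> n \<and> G \<subseteq> span (B \<union> N)"
  shows "\<exists>gs. length gs = n \<and> (\<forall>N\<in>\<N>. G \<subseteq> span (set gs \<union> N))"
  using assms(3,4)
proof (induction n arbitrary: \<N>)
  case 0
  then show ?case by fastforce
next
  case (Suc n)
  have "\<exists>g\<in>G. \<forall>M \<in> span ` {N\<in>\<N>. \<not> G \<subseteq> span N}. g \<notin> M"
    by (rule subspace_avoids_finite_union) (use assms Suc.prems in auto)
  then obtain g where g: "g \<in> G" "\<And>N. N \<in> \<N> \<Longrightarrow> \<not> G \<subseteq> span N \<Longrightarrow> g \<notin> span N" by auto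
  have "\<exists>B. finite B \<and> card B \<le> n \<and> G \<subseteq> span (B \<union> insert g N)" if N: "N \<in> \<N>" for N
  proof (cases "G \<subseteq> span N")
    case True
    then have "G \<subseteq> span (insert g N)" using span_mono[of N "insert g N"] by blast
    then show ?thesis by (intro exI[of _ "{}"]) auto
  next
    case False
    obtain B where B: "finite B" "card B \<le> Suc n" "G \<subseteq> span (B \<union> N)"
      using Suc.prems(2)[OF N] by blast
    then obtain b where b: "b \<in> B" "b \<in> span (insert g (B - {b} \<union> N))"
      using span_exchange_modulo[of B g N] g False N by blast
    have "B \<union> N \<subseteq> span (insert g (B - {b} \<union> N))"
      using b(2) span_superset[of "insert g (B - {b} \<union> N)"] by blast
    then have "span (B \<union> N) \<subseteq> span (insert g (B - {b} \<union> N))"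
      by (rule span_minimal) simp
    with B(3) have "G \<subseteq> span (B - {b} \<union> insert g N)" by simp
    moreover have "card (B - {b}) \<le> n" using B b by simp
    ultimately show ?thesis using B(1) by blast
  qed
  then have "\<exists>B. finite B \<and> card B \<le> n \<and> G \<subseteq> span (B \<union> M)" if "M \<in> insert g ` \<N>" for M
    using that by blast
  then obtain gs where gs: "length gs = n" "\<forall>N \<in> insert g ` \<N>. G \<subseteq> span (set gs \<union> N)"
    using Suc.IH[of "insert g ` \<N>"] Suc.prems(1) by blast
  then show ?case by (intro exI[of _ "g # gs"]) auto
qed

end

section \<open>Spaces of functions and forms\<close>

interpretation fun_space: vector_space "\<lambda>c (f :: 'p \<Rightarrow> 'f::field) x. c * f x"
  by unfold_locales (auto simp: fun_eq_iff algebra_simps)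

lemma fun_space_subspace_vanishing: "fun_space.subspace {f :: 'p \<Rightarrow> 'f::field. \<forall>x\<in>Q. f x = 0}"
  by (auto simp: fun_space.subspace_def)

text \<open>Each point imposes at most one linear condition, so the vanishing subspace has
  codimension at most the number of points, whatever the dimension of \<open>G\<close>.\<close>

lemma codim_vanishing_le_card:
  fixes G :: "('p \<Rightarrow> 'f::field) set"
  assumes "fun_space.subspace G" and "finite Q"
  shows "\<exists>B. finite B \<and> card B \<le> card Q \<and> G \<subseteq> fun_space.span (B \<union> {f\<in>G. \<forall>q\<in>Q. f q = 0})"
  using assms(2)
proof (induction Q rule: finite_induct)
  case empty
  show ?case by (intro exI[of _ "{}"]) (simp add: fun_space.span_superset)
next
  case (insert q Q)
  let ?N = "{f\<in>G. \<forall>x\<in>Q. f x = 0}" and ?N' = "{f\<in>G. \<forall>x\<in>insert q Q. f x = 0}"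
  obtain B where B: "finite B" "card B \<le> card Q" "G \<subseteq> fun_space.span (B \<union> ?N)"
    using insert.IH by blast
  show ?case
  proof (cases "\<forall>f\<in>?N. f q = 0")
    case True
    then have "?N' = ?N" by auto
    with B insert.hyps show ?thesis by (metis (no_types, lifting) card_insert_disjoint le_SucI)
  next
    case False
    then obtain b where b: "b \<in> ?N" "b q \<noteq> 0" by blast
    let ?U = "fun_space.span (insert b B \<union> ?N')"
    have "f \<in> ?U" if f: "f \<in> ?N" for f
    proof -
      \<comment> \<open>The multiple of \<open>b\<close> cancels the value of \<open>f\<close> at
        \<open>q\<close> and, since \<open>b\<close> vanishes on \<open>Q\<close>, creates none
        there.\<close>
      let ?r = "f - (\<lambda>x. f q / b q * b x)"
      have "?r \<in> G"
        using f b assms(1) by (intro fun_space.subspace_diff fun_space.subspace_scale) auto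
      then have "?r \<in> ?N'" using f b by auto
      then have "?r \<in> ?U" by (intro fun_space.span_base) blast
      moreover have "(\<lambda>x. f q / b q * b x) \<in> ?U"
        by (intro fun_space.span_scale fun_space.span_base) blast
      ultimately have "?r + (\<lambda>x. f q / b q * b x) \<in> ?U" by (rule fun_space.span_add)
      then show ?thesis by simp
    qed
    moreover have "B \<subseteq> ?U" using fun_space.span_superset[of "insert b B \<union> ?N'"] by blast
    ultimately have "fun_space.span (B \<union> ?N) \<subseteq> ?U"
      by (intro fun_space.span_minimal) auto
    moreover have "card (insert b B) \<le> card (insert q Q)"
      using B insert.hyps by (simp add: card_insert_if)
    ultimately show ?thesis using B by (intro exI[of _ "insert b B"]) auto
  qed
qed

text \<open>The products of \<open>t\<close> members of the list, repetitions allowed, as functions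
  rather than formal expressions. The recursion asks whether the head occurs as a factor.\<close>

fun monomials :: "('p \<Rightarrow> 'f::field) list \<Rightarrow> nat \<Rightarrow> ('p \<Rightarrow> 'f) set" where
  "monomials gs 0 = {\<lambda>x. 1}"
| "monomials [] (Suc t) = {}"
| "monomials (g # gs) (Suc t) =
     monomials gs (Suc t) \<union> (\<lambda>f x. g x * f x) ` monomials (g # gs) t"

lemma finite_monomials: "finite (monomials gs t)"
  by (induction gs t rule: monomials.induct) auto

text \<open>The recursion of \<open>monomials\<close> is Pascal's rule. Only an inequality holds,
  since different formal monomials may agree as functions. For the empty list and degree 0 the
  truncated subtraction gives \<open>0 choose 0 = 1\<close>, as it should.\<close>

lemma card_monomials_le: "card (monomials gs t) \<le> (length gs + t - 1) choose t"
proof (induction gs t rule: monomials.induct)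
  case (3 g gs t)
  have "card (monomials (g # gs) (Suc t)) \<le> card (monomials gs (Suc t)) +
          card ((\<lambda>f x. g x * f x) ` monomials (g # gs) t)"
    by (simp add: card_Un_le)
  also have "\<dots> \<le> card (monomials gs (Suc t)) + card (monomials (g # gs) t)"
    by (simp add: card_image_le finite_monomials)
  also have "\<dots> \<le> (length gs + t choose Suc t) + (length gs + t choose t)"
    using 3 by (intro add_mono) auto
  finally show ?case by simp
qed auto

text \<open>The recursion multiplies by the head only. For another factor \<open>g\<close>, a head
  \<open>h\<close> occurring in \<open>f\<close> is pulled out first and put back after multiplying
  by \<open>g\<close>.\<close>

lemma mult_in_monomials:
  assumes "g \<in> set gs" and "f \<in> monomials gs t"
  shows "(\<lambda>x. g x * f x) \<in> monomials gs (Suc t)"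
  using assms
proof (induction gs t arbitrary: f rule: monomials.induct)
  case (1 gs)
  then show ?case by (induction gs) auto
next
  case (3 h gs t)
  show ?case
  proof (cases "g = h")
    case True
    with 3 show ?thesis by auto
  next
    case False
    with 3 have g: "g \<in> set gs" by simp
    from 3(4) consider "f \<in> monomials gs (Suc t)"
      | f' where "f' \<in> monomials (h # gs) t" "f = (\<lambda>x. h x * f' x)" by auto
    then show ?thesis
    proof cases
      case 1
      with 3(1) g show ?thesis by simp
    next
      case 2
      then have "(\<lambda>x. g x * f' x) \<in> monomials (h # gs) (Suc t)" using 3(2,3) by blast
      then have "(\<lambda>x. h x * (g x * f' x)) \<in> monomials (h # gs) (Suc (Suc t))"
        by (simp del: monomials.simps(3) add: monomials.simps(3)[of h gs "Suc t"])
      with 2 show ?thesis by (simp only: mult.left_commute)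
    qed
  qed
qed simp

text \<open>The product is bilinear, so the case of a generator times a monomial extends by span
  induction, first in \<open>f\<close> and then in \<open>l\<close>.\<close>

lemma mult_in_span_monomials:
  assumes "l \<in> fun_space.span (set gs)" and "f \<in> fun_space.span (monomials gs t)"
  shows "(\<lambda>x. l x * f x) \<in> fun_space.span (monomials gs (Suc t))"
proof -
  let ?U = "fun_space.span (monomials gs (Suc t))"
  have *: "(\<lambda>x. g x * f x) \<in> ?U" if "g \<in> set gs" for g
    using assms(2)
  proof (induction rule: fun_space.span_induct_alt)
    case base
    show ?case using fun_space.span_zero[of "monomials gs (Suc t)"] by (simp add: zero_fun_def)
  next
    case (step c m y)
    have "(\<lambda>x. g x * m x) \<in> ?U"
      using mult_in_monomials[OF that step(1)] by (rule fun_space.span_base)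
    then have "(\<lambda>x. c * (g x * m x)) + (\<lambda>x. g x * y x) \<in> ?U"
      using step(2) by (intro fun_space.span_add fun_space.span_scale)
    then show ?case by (simp add: plus_fun_def algebra_simps)
  qed
  show ?thesis
    using assms(1)
  proof (induction rule: fun_space.span_induct_alt)
    case base
    show ?case using fun_space.span_zero[of "monomials gs (Suc t)"] by (simp add: zero_fun_def)
  next
    case (step c g y)
    have "(\<lambda>x. c * (g x * f x)) + (\<lambda>x. y x * f x) \<in> ?U"
      using step * by (intro fun_space.span_add fun_space.span_scale) auto
    then show ?case by (simp add: plus_fun_def algebra_simps)
  qed
qed

lemma prod_in_span_monomials:
  assumes "\<And>i. i < t \<Longrightarrow> l i \<in> fun_space.span (set gs)"
  shows "(\<lambda>x. \<Prod>i<t. l i x) \<in> fun_space.span (monomials gs t)"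
  using assms
proof (induction t)
  case 0
  show ?case by (auto intro: fun_space.span_base)
next
  case (Suc t)
  then have "(\<lambda>x. l t x * (\<Prod>i<t. l i x)) \<in> fun_space.span (monomials gs (Suc t))"
    by (intro mult_in_span_monomials) auto
  then show ?case by (simp add: mult.commute)
qed

text \<open>The matrix of values \<open>f x y\<close> over \<open>S\<close> is diagonal with nonzero
  diagonal. Hence the products are distinct and independent, inside a space spanned by the monomials
  of degree \<open>t\<close>.\<close>

lemma card_le_if_diagonal_products:
  fixes l :: "'p \<Rightarrow> nat \<Rightarrow> 'p \<Rightarrow> 'f::field"
  assumes "\<And>x i. x \<in> S \<Longrightarrow> i < t \<Longrightarrow> l x i \<in> fun_space.span (set gs)"
    and "\<And>x i. x \<in> S \<Longrightarrow> i < t \<Longrightarrow> l x i x \<noteq> 0"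
    and "\<And>x y. x \<in> S \<Longrightarrow> y \<in> S \<Longrightarrow> y \<noteq> x \<Longrightarrow> \<exists>i<t. l x i y = 0"
  shows "card S \<le> (length gs + t - 1) choose t"
proof -
  define f where "f x = (\<lambda>y. \<Prod>i<t. l x i y)" for x
  have diag: "f x x \<noteq> 0" if "x \<in> S" for x using assms(2) that by (simp add: f_def)
  have off: "f x y = 0" if "x \<in> S" "y \<in> S" "y \<noteq> x" for x y
    using assms(3)[OF that] by (auto simp: f_def)
  have "inj_on f S" using diag off by (metis inj_onI)
  have "fun_space.independent (f ` S)"
    unfolding fun_space.dependent_def
  proof safe
    fix x assume x: "x \<in> S" and span: "f x \<in> fun_space.span (f ` S - {f x})"
    \<comment> \<open>All other products vanish at \<open>x\<close>, hence so does their span, which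
      therefore misses \<open>f x\<close>.\<close>
    have "f ` S - {f x} \<subseteq> {g. \<forall>y\<in>{x}. g y = 0}" using off x by auto
    then have "fun_space.span (f ` S - {f x}) \<subseteq> {g. \<forall>y\<in>{x}. g y = 0}"
      using fun_space_subspace_vanishing by (rule fun_space.span_minimal)
    with span diag[OF x] show False by auto
  qed
  moreover have "f ` S \<subseteq> fun_space.span (monomials gs t)"
    using assms(1) by (auto simp: f_def intro: prod_in_span_monomials)
  ultimately have "card (f ` S) \<le> card (monomials gs t)"
    using fun_space.independent_span_bound finite_monomials by blast
  with card_monomials_le[of gs t] card_image[OF \<open>inj_on f S\<close>] show ?thesis by simp
qed

section \<open>Affine functions with values in an extension field\<close>

locale affine_space_extension = fin_dim_affine_space scale translate
  for scale :: "'k::field \<Rightarrow> 'v::ab_group_add \<Rightarrow> 'v" (infixr \<open>*s\<close> 75)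
    and translate :: "'p \<Rightarrow> 'v \<Rightarrow> 'p" (infixl \<open>\<oplus>\<close> 65) +
  fixes embed :: "'k \<Rightarrow> 'f::field"
  assumes embed_add: "embed (a + b) = embed a + embed b"
    and embed_mult: "embed (a * b) = embed a * embed b"
    and embed_one: "embed 1 = 1"
begin

text \<open>The conditions say that for every \<open>p\<close> the map taking \<open>w\<close> to
  \<open>f (p \<oplus> w) - f p\<close> is linear over the small field, acting through
  \<open>embed\<close>. No origin is chosen. The values lie in the large field, so these functions
  form a vector space over it.\<close>

definition affine_functions :: "('p \<Rightarrow> 'f) set" where
  "affine_functions = {f. \<forall>p u w c. f (p \<oplus> (u + w)) + f p = f (p \<oplus> u) + f (p \<oplus> w) \<and>
                                  f (p \<oplus> (c *s w)) = f p + embed c * (f (p \<oplus> w) - f p)}"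

lemma subspace_affine_functions: "fun_space.subspace affine_functions"
  unfolding fun_space.subspace_def
proof (intro conjI ballI allI)
  show "0 \<in> affine_functions" by (simp add: affine_functions_def)
next
  fix f g assume f: "f \<in> affine_functions" and g: "g \<in> affine_functions"
  show "f + g \<in> affine_functions"
    unfolding affine_functions_def
  proof (intro CollectI allI conjI)
    fix p u w c
    have "f (p \<oplus> (u + w)) + f p = f (p \<oplus> u) + f (p \<oplus> w)"
      "g (p \<oplus> (u + w)) + g p = g (p \<oplus> u) + g (p \<oplus> w)"
      using f g by (auto simp: affine_functions_def)
    then show "(f + g) (p \<oplus> (u + w)) + (f + g) p = (f + g) (p \<oplus> u) + (f + g) (p \<oplus> w)"
      unfolding plus_fun_apply by algebra
    have "f (p \<oplus> (c *s w)) = f p + embed c * (f (p \<oplus> w) - f p)"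
      "g (p \<oplus> (c *s w)) = g p + embed c * (g (p \<oplus> w) - g p)"
      using f g by (auto simp: affine_functions_def)
    then show "(f + g) (p \<oplus> (c *s w)) = (f + g) p + embed c * ((f + g) (p \<oplus> w) - (f + g) p)"
      by (simp add: algebra_simps)
  qed
next
  fix a f assume f: "f \<in> affine_functions"
  show "(\<lambda>x. a * f x) \<in> affine_functions"
    unfolding affine_functions_def
  proof (intro CollectI allI conjI)
    fix p u w c
    have "f (p \<oplus> (u + w)) + f p = f (p \<oplus> u) + f (p \<oplus> w)"
      using f by (auto simp: affine_functions_def)
    then show "a * f (p \<oplus> (u + w)) + a * f p = a * f (p \<oplus> u) + a * f (p \<oplus> w)"
      by (metis distrib_left)
    have *: "f (p \<oplus> (c *s w)) = f p + embed c * (f (p \<oplus> w) - f p)"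
      using f by (auto simp: affine_functions_def)
    show "a * f (p \<oplus> (c *s w)) = a * f p + embed c * (a * f (p \<oplus> w) - a * f p)"
      unfolding * by (simp add: algebra_simps)
  qed
qed

lemma affine_function_vanishes_on_span:
  assumes f: "f \<in> affine_functions" and "f p = 0" and "\<And>b. b \<in> B \<Longrightarrow> f (p \<oplus> b) = 0"
    and "w \<in> span B"
  shows "f (p \<oplus> w) = 0"
proof -
  have add: "f (p \<oplus> (u + w)) = f (p \<oplus> u) + f (p \<oplus> w)"
    and scale: "f (p \<oplus> (c *s w)) = embed c * f (p \<oplus> w)" for u w c
    using f \<open>f p = 0\<close> by (auto simp: affine_functions_def dest: spec[of _ p])
  show ?thesis
    using assms(4)
    by (induction rule: span_induct_alt) (simp_all add: translate_zero add scale assms)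
qed

text \<open>A linear functional over the small field that is 0 on \<open>W\<close> and 1 on the
  vector from \<open>p\<close> to \<open>x\<close>, composed with \<open>embed\<close>.\<close>

lemma separating_affine_function:
  assumes "subspace W" and x: "x \<notin> (\<lambda>w. p \<oplus> w) ` W"
  shows "\<exists>h\<in>affine_functions. (\<forall>w\<in>W. h (p \<oplus> w) = 0) \<and> h x = 1"
proof -
  \<comment> \<open>With \<open>p\<close> as origin, points become vectors and the affine subspace
    becomes \<open>W\<close>.\<close>
  define diff where "diff q = (THE w. p \<oplus> w = q)" for q
  have diff: "p \<oplus> diff q = q" for q
    unfolding diff_def using translate_unique by (rule theI')
  have diff_eq: "diff (p \<oplus> w) = w" for w
    using diff translate_unique by metis
  have diff_add: "diff (q \<oplus> w) = diff q + w" for q w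
    using diff diff_eq translate_add by metis
  have u: "diff x \<notin> W" using x diff by (metis image_eqI)
  obtain B where B: "B \<subseteq> W" "independent B" "W \<subseteq> span B"
    by (rule maximal_independent_subset)
  have "span B \<subseteq> W" using B(1) assms(1) by (rule span_minimal)
  with B u have "independent (insert (diff x) B)" using independent_insertI by blast
  interpret vector_space_pair scale "(*) :: 'k \<Rightarrow> 'k \<Rightarrow> 'k"
    by unfold_locales (auto simp: algebra_simps)
  obtain \<phi> where \<phi>: "Vector_Spaces.linear scale (*) \<phi>"
    "\<forall>b\<in>insert (diff x) B. \<phi> b = (if b = diff x then 1 else 0)"
    using linear_independent_extend[OF \<open>independent (insert (diff x) B)\<close>,
        where f = "\<lambda>b. if b = diff x then 1 else 0"] by blast
  interpret \<phi>: Vector_Spaces.linear scale "(*)" \<phi> by (rule \<phi>(1))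
  have "\<phi> b = 0" if "b \<in> B" for b using \<phi>(2) that u B(1) by auto
  then have \<phi>_W: "\<phi> w = 0" if "w \<in> W" for w
    using linear_eq_0_on_span[OF \<phi>(1)] that B(3) by blast
  have embed_zero: "embed 0 = 0" using embed_add[of 0 0] by (metis add.right_neutral add_left_cancel)
  define h where "h q = embed (\<phi> (diff q))" for q
  have "h \<in> affine_functions"
    by (simp add: affine_functions_def h_def diff_add \<phi>.add \<phi>.scale embed_add embed_mult
        algebra_simps)
  moreover have "h x = 1" by (simp add: h_def \<phi>(2) embed_one)
  moreover have "h (p \<oplus> w) = 0" if "w \<in> W" for w
    by (simp add: h_def diff_eq \<phi>_W that embed_zero)
  ultimately show ?thesis by blast
qed

text \<open>An affine function vanishes on \<open>L\<close> once it vanishes at \<open>p\<close> and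
  at the translates of \<open>p\<close> by a basis of \<open>W\<close>. That makes at most
  \<open>k + 1\<close> points, and \<open>x\<close> is one more.\<close>

lemma codim_vanishing_on_affine_subspace_le:
  assumes "affine_subspace_of_dim L d" and "d \<le> k"
  shows "\<exists>B. finite B \<and> card B \<le> k + 2 \<and>
           affine_functions \<subseteq> fun_space.span (B \<union> {f\<in>affine_functions. \<forall>q\<in>insert x L. f q = 0})"
proof -
  obtain p W where W: "subspace W" "dim W = d" "L = (\<lambda>w. p \<oplus> w) ` W"
    using assms(1) by (auto simp: affine_subspace_of_dim_def)
  obtain C where C: "C \<subseteq> W" "independent C" "W \<subseteq> span C" "card C = dim W"
    using basis_exists by blast
  \<comment> \<open>Finiteness of \<open>C\<close> needs an argument of its own:
    \<open>card C = dim W\<close> does not give it, as \<open>card\<close> is 0 on infinite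
    sets.\<close>
  obtain B\<^sub>0 where "finite B\<^sub>0" "span B\<^sub>0 = UNIV" using finite_dimensional by blast
  then have "finite C" using independent_span_bound[of B\<^sub>0 C] C(2) by blast
  let ?Q = "insert x (insert p ((\<lambda>w. p \<oplus> w) ` C))"
  have "card ((\<lambda>w. p \<oplus> w) ` C) \<le> k"
    using card_image_le[OF \<open>finite C\<close>, of "\<lambda>w. p \<oplus> w"] C(4) W(2) assms(2) by linarith
  then have "card ?Q \<le> k + 2" using \<open>finite C\<close> by (simp add: card_insert_if)
  moreover obtain B where B: "finite B" "card B \<le> card ?Q"
    "affine_functions \<subseteq> fun_space.span (B \<union> {f\<in>affine_functions. \<forall>q\<in>?Q. f q = 0})"
    using codim_vanishing_le_card[OF subspace_affine_functions, of ?Q] \<open>finite C\<close> by auto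
  moreover have "{f\<in>affine_functions. \<forall>q\<in>?Q. f q = 0}
      \<subseteq> {f\<in>affine_functions. \<forall>q\<in>insert x L. f q = 0}"
    using affine_function_vanishes_on_span[of _ p C] C(3) W(3) by auto
  then have "fun_space.span (B \<union> {f\<in>affine_functions. \<forall>q\<in>?Q. f q = 0})
      \<subseteq> fun_space.span (B \<union> {f\<in>affine_functions. \<forall>q\<in>insert x L. f q = 0})"
    by (intro fun_space.span_mono Un_mono order_refl)
  ultimately show ?thesis by (intro exI[of _ B]) auto
qed

lemma generic_affine_functions_separate:
  assumes "infinite (UNIV :: 'f set)" and "finite P"
    and "\<And>L x. (L, x) \<in> P \<Longrightarrow> x \<notin> L \<and> (\<exists>d\<le>k. affine_subspace_of_dim L d)"
  shows "\<exists>gs :: ('p \<Rightarrow> 'f) list. length gs = k + 2 \<and>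
           (\<forall>(L, x)\<in>P. \<exists>l\<in>fun_space.span (set gs). (\<forall>q\<in>L. l q = 0) \<and> l x \<noteq> 0)"
proof -
  \<comment> \<open>Vanishing at \<open>x\<close> is included so that changing a separating function
    by an element of \<open>N L x\<close> alters its values neither on \<open>L\<close> nor at
    \<open>x\<close>.\<close>
  define N where "N L x = {f\<in>affine_functions. \<forall>q\<in>insert x L. f q = 0}" for L x
  have "\<exists>gs. length gs = k + 2 \<and>
          (\<forall>M\<in>(\<lambda>(L, x). N L x) ` P. affine_functions \<subseteq> fun_space.span (set gs \<union> M))"
  proof (rule fun_space.common_complement_of_subspaces[OF assms(1) subspace_affine_functions])
    show "finite ((\<lambda>(L, x). N L x) ` P)" using assms(2) by simp
    show "\<exists>B. finite B \<and> card B \<le> k + 2 \<and> affine_functions \<subseteq> fun_space.span (B \<union> M)"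
      if "M \<in> (\<lambda>(L, x). N L x) ` P" for M
      using that assms(3) codim_vanishing_on_affine_subspace_le by (fastforce simp: N_def)
  qed
  then obtain gs where gs: "length gs = k + 2"
    "\<And>L x. (L, x) \<in> P \<Longrightarrow> affine_functions \<subseteq> fun_space.span (set gs \<union> N L x)" by fast
  have "\<exists>l\<in>fun_space.span (set gs). (\<forall>q\<in>L. l q = 0) \<and> l x \<noteq> 0" if P: "(L, x) \<in> P" for L x
  proof -
    obtain p W where W: "subspace W" "L = (\<lambda>w. p \<oplus> w) ` W"
      using assms(3)[OF P] by (auto simp: affine_subspace_of_dim_def)
    then obtain h where h: "h \<in> affine_functions" "\<forall>q\<in>L. h q = 0" "h x = 1"
      using separating_affine_function[OF W(1)] assms(3)[OF P] by blast
    then have "h \<in> fun_space.span (set gs \<union> N L x)" using gs(2)[OF P] by blast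
    \<comment> \<open>The component \<open>l\<close> inherits the separation from \<open>h\<close>,
      because \<open>r\<close> is zero on \<open>L\<close> and at \<open>x\<close>.\<close>
    then obtain l r where lr: "h = l + r" "l \<in> fun_space.span (set gs)" "r \<in> fun_space.span (N L x)"
      unfolding fun_space.span_Un by blast
    have "fun_space.span (N L x) \<subseteq> {f. \<forall>q\<in>insert x L. f q = 0}"
      by (rule fun_space.span_minimal[OF _ fun_space_subspace_vanishing]) (auto simp: N_def)
    with lr(3) have r: "\<forall>q\<in>insert x L. r q = 0" by blast
    have "\<forall>q\<in>L. l q = 0" "l x = 1" using h r lr(1) by auto
    with lr(2) show ?thesis by (intro bexI[of _ l]) auto
  qed
  with gs(1) show ?thesis by (intro exI[of _ gs] conjI ballI case_prodI2) blast+
qed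

section \<open>The size of nearly covered sets and the covering number\<close>

lemma card_nearly_covered_le:
  assumes "infinite (UNIV :: 'f set)" and "finite S"
    and V: "\<And>v. v \<in> V \<Longrightarrow> v \<noteq> [] \<and> length v \<le> t \<and> (\<forall>d\<in>set v. d \<le> k)"
    and "\<not> covered_by S V" and near: "\<And>T. T \<subset> S \<Longrightarrow> covered_by T V"
  shows "card S \<le> (t + k + 1) choose (k + 1)"
proof -
  have "\<exists>L. (\<forall>i<t. x \<notin> L i \<and> (\<exists>d\<le>k. affine_subspace_of_dim (L i) d)) \<and> S - {x} \<subseteq> (\<Union>i<t. L i)"
    if x: "x \<in> S" for x
  proof -
    obtain v L where v: "v \<in> V" and L: "\<And>i. i < length v \<Longrightarrow> affine_subspace_of_dim (L i) (v ! i)"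
      and cover: "S - {x} \<subseteq> (\<Union>i<length v. L i)"
      using near[of "S - {x}"] x by (auto simp: covered_by_def covered_by_vector_def)
    \<comment> \<open>A subspace through \<open>x\<close> would turn the cover of
      \<open>S - {x}\<close> into a cover of \<open>S\<close>.\<close>
    have x_notin: "x \<notin> L i" if "i < length v" for i
    proof
      assume "x \<in> L i"
      with cover that have "S \<subseteq> (\<Union>i<length v. L i)" by blast
      with L v have "covered_by S V" unfolding covered_by_def covered_by_vector_def by blast
      with assms(4) show False ..
    qed
    \<comment> \<open>Padding to exactly \<open>t\<close> subspaces by repeating \<open>L 0\<close>,
      which exists because \<open>v\<close> is nonempty. All products then have the same degree
      \<open>t\<close>.\<close>
    define L' where "L' i = L (if i < length v then i else 0)" for i
    have "x \<notin> L' i \<and> (\<exists>d\<le>k. affine_subspace_of_dim (L' i) d)" for i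
    proof -
      obtain j where "j < length v" "L' i = L j"
        using V[OF v] that[of "if i < length v then i else 0"] by (auto simp: L'_def)
      then show ?thesis using L x_notin V[OF v] by (metis nth_mem)
    qed
    moreover have "(\<Union>i<length v. L i) \<subseteq> (\<Union>i<t. L' i)"
      using V[OF v] by (intro UN_mono) (auto simp: L'_def)
    with cover have "S - {x} \<subseteq> (\<Union>i<t. L' i)" by (rule order_trans)
    ultimately show ?thesis by (intro exI[of _ L'] conjI allI impI) simp_all
  qed
  then obtain L where L: "\<And>x i. x \<in> S \<Longrightarrow> i < t \<Longrightarrow>
      x \<notin> L x i \<and> (\<exists>d\<le>k. affine_subspace_of_dim (L x i) d)"
    and cover: "\<And>x. x \<in> S \<Longrightarrow> S - {x} \<subseteq> (\<Union>i<t. L x i)" by metis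
  let ?P = "(\<lambda>(x, i). (L x i, x)) ` (S \<times> {..<t})"
  obtain gs :: "('p \<Rightarrow> 'f) list" where gs: "length gs = k + 2"
    and sep: "\<forall>(L, x)\<in>?P. \<exists>l\<in>fun_space.span (set gs). (\<forall>q\<in>L. l q = 0) \<and> l x \<noteq> 0"
  proof -
    have "finite ?P" using assms(2) by simp
    moreover have "y \<notin> M \<and> (\<exists>d\<le>k. affine_subspace_of_dim M d)" if "(M, y) \<in> ?P" for M y
      using that L by auto
    ultimately show thesis
      using that generic_affine_functions_separate[OF assms(1), of ?P k] by blast
  qed
  have "\<exists>l\<in>fun_space.span (set gs). (\<forall>q\<in>L x i. l q = 0) \<and> l x \<noteq> 0" if "x \<in> S" "i < t" for x i
  proof -
    have "(L x i, x) \<in> ?P" using that by force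
    with sep show ?thesis by blast
  qed
  then obtain l where l: "\<And>x i. x \<in> S \<Longrightarrow> i < t \<Longrightarrow>
      l x i \<in> fun_space.span (set gs) \<and> (\<forall>q\<in>L x i. l x i q = 0) \<and> l x i x \<noteq> 0" by metis
  have "card S \<le> (length gs + t - 1) choose t"
  proof (rule card_le_if_diagonal_products[where l = l])
    show "\<exists>i<t. l x i y = 0" if "x \<in> S" "y \<in> S" "y \<noteq> x" for x y
    proof -
      have "y \<in> (\<Union>i<t. L x i)" using cover that by blast
      with l that show ?thesis by blast
    qed
  qed (use l in blast)+
  \<comment> \<open>With \<open>k + 2\<close> functions the count is
    \<open>(t + k + 1) choose t\<close>, and symmetry exchanges \<open>t\<close> for
    \<open>k + 1\<close>.\<close>
  also have "\<dots> = (t + k + 1) choose (k + 1)"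
    using binomial_symmetric[of t "t + k + 1"] gs by (simp add: algebra_simps)
  finally show ?thesis .
qed

text \<open>A minimal uncovered subset \<open>T\<close> of \<open>S\<close> would be nearly covered,
  hence within the bound, hence covered by assumption. Induction over proper subsets excludes
  it.\<close>

lemma covering_number_le:
  assumes "infinite (UNIV :: 'f set)"
    and "\<And>v. v \<in> V \<Longrightarrow> v \<noteq> [] \<and> length v \<le> t \<and> (\<forall>d\<in>set v. d \<le> k)"
  shows "covering_number V \<le> enat ((t + k + 1) choose (k + 1))"
proof -
  let ?n = "(t + k + 1) choose (k + 1)"
  have "covered_by S V"
    if "finite S" and small: "\<forall>T. T \<subseteq> S \<and> card T \<le> ?n \<longrightarrow> covered_by T V" for S
  proof -
    have "covered_by T V" if "T \<subseteq> S" for T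
      using finite_subset[OF that \<open>finite S\<close>] that
    proof (induction T rule: finite_psubset_induct)
      case (psubset T)
      show ?case
      proof (rule ccontr)
        assume uncovered: "\<not> covered_by T V"
        have "covered_by U V" if "U \<subset> T" for U
          using psubset that by blast
        with uncovered have "card T \<le> ?n"
          by (intro card_nearly_covered_le[OF assms(1) psubset.hyps assms(2)])
        with small psubset.prems uncovered show False by blast
      qed
    qed
    then show ?thesis by blast
  qed
  then show ?thesis
    unfolding covering_number_def by (intro Inf_lower) blast
qed

end

text \<open>The powers of the indeterminate are distinct, so the rational functions are infinite
  even over a finite field.\<close>

lemma infinite_UNIV_poly_fract: "infinite (UNIV :: 'k::field poly fract set)"
proof -
  have "inj (\<lambda>n. Fract (monom (1 :: 'k) n) 1)"
    by (auto simp: inj_def eq_fract monom_eq_iff')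
  then show ?thesis by (rule infinite_super[OF subset_UNIV range_inj_infinite])
qed

theorem theorem9:
  fixes scale :: "'k::field \<Rightarrow> 'v::ab_group_add \<Rightarrow> 'v"
    and translate :: "'p \<Rightarrow> 'v \<Rightarrow> 'p"
    and V :: "nat list set"
    and t k :: nat
  assumes "fin_dim_affine_space scale translate"
    and "finite V" and "V \<noteq> {}"
    and "\<forall>v\<in>V. dimension_vector v \<and> length v \<le> t"
    and "k = (MAX v\<in>V. Max (set v))"
  shows "fin_dim_affine_space.covering_number scale translate V
           \<le> enat ((t + k + 1) choose (k + 1))"
proof -
  \<comment> \<open>The extension is the field of rational functions in one variable, with scalars
    embedded as constants.\<close>
  interpret affine_space_extension scale translate "\<lambda>c. Fract [:c:] 1"
    using assms(1)
    by (rule affine_space_extension.intro)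
      (unfold_locales, simp_all add: One_fract_def pCons_one mult.commute)
  have "d \<le> k" if "v \<in> V" "d \<in> set v" for v d
  proof -
    have "d \<le> Max (set v)" using that(2) by simp
    also have "\<dots> \<le> k" using assms(2,5) that(1) by simp
    finally show ?thesis .
  qed
  then show ?thesis
    using assms(4) infinite_UNIV_poly_fract
    by (intro covering_number_le) (auto simp: dimension_vector_def)
qed

end
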